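(* For any $p>1$ and $k\in\mathbb{N}_0$, we have \[ m_{2k}^{(p)}=2\left(\frac{p-1}{p}\right)^{p-1}\sum_{n=1}^{2k+1}\binom{p-1}{n}\sum_{\substack{r_1,\dots,r_n\ge1\\ r_1+\dots+r_n=2k+1}}\frac{(1/p)_{r_1}}{(r_1+1)!}\cdots\frac{(1/p)_{r_n}}{(r_n+1)!}, \] where $(\alpha)_n:=\alpha(\alpha+1)\cdots(\alpha+n-1)$ is the Pochhammer symbol.
   Context: Let $p>1$ be real and let $q>1$ be the Hölder conjugate index, $1/p+1/q=1$. For $\alpha>0$ the power of a complex number is taken in the principal branch: $z^{\alpha}:=|z|^{\alpha}e^{i\alpha\operatorname{Arg} z}$ with $\operatorname{Arg} z\in(-\pi,\pi]$ (and $0^\alpha=0$). $\mathbb{N}_0=\{0,1,2,\dots\}$. The function $\rho_p$ is defined for $x\in(0,1]$ by \[ \rho_p(x):=-\frac1\pi\,x^{p-1}\operatorname{Im}\left[\left(1-e^{i\pi/q}\left(\frac1x-1\right)^{1/q}\right)^{p-1}\right], \] and its value at $0$ is understood as the limit of $\rho_p(x)$ for $x\to0_+$ (this limit is $\rho_p(0)=0$). The moments are \[ m_{2k}^{(p)}:=\int_{-1}^{1}t^{2k}\rho_p(|t|)\,dt,\qquad k\in\mathbb{N}_0. \] $\binom{p-1}{n}=\frac{(p-1)(p-2)\cdots(p-n)}{n!}$ is the generalized binomial coefficient; the indices $r_1,\dots,r_n$ in the inner sum are integers (the inner sum runs over ordered $n$-tuples). *)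

theory Defs
  imports "HOL-Analysis.Analysis"
begin

definition hoelder_conj :: "real \<Rightarrow> real" where
  "hoelder_conj p = p / (p - 1)"

lemma hoelder_conj_iff:
  fixes p q :: real
  assumes "p > 1"
  shows "q = hoelder_conj p \<longleftrightarrow> q > 1 \<and> 1 / p + 1 / q = 1"
proof
  assume "q = hoelder_conj p"
  thus "q > 1 \<and> 1 / p + 1 / q = 1"
    using assms by (simp add: hoelder_conj_def diff_divide_distrib flip: add_divide_distrib)
next
  assume "q > 1 \<and> 1 / p + 1 / q = 1"
  thus "q = hoelder_conj p"
    using assms by (auto simp: hoelder_conj_def field_simps)
qed

(* The library's complex powr is the principal branch: Im (Ln z) ranges over (-pi, pi],
   and 0 powr a = 0. *)
lemma powr_principal_branch:
  fixes a :: real and z :: complex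
  assumes "a > 0"
  shows "z powr of_real a = of_real (norm z powr a) * exp (\<i> * of_real (a * Arg z))"
proof (cases "z = 0")
  case False
  then have "Ln z = of_real (ln (norm z)) + \<i> * of_real (Arg z)"
    by (simp add: complex_eq_iff Arg_eq_Im_Ln)
  then show ?thesis
    using False by (simp add: powr_def exp_add ring_distribs mult_ac flip: exp_of_real)
qed auto

definition rho_formula :: "real \<Rightarrow> real \<Rightarrow> real" where
  "rho_formula p x =
     - (1 / pi) * x powr (p - 1) *
       Im ((1 - exp (\<i> * of_real (pi / hoelder_conj p)) *
                 of_real ((1 / x - 1) powr (1 / hoelder_conj p))) powr of_real (p - 1))"

definition rho :: "real \<Rightarrow> real \<Rightarrow> real" where
  "rho p x = (if x = 0 then Lim (at_right 0) (rho_formula p) else rho_formula p x)"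

definition moment :: "real \<Rightarrow> nat \<Rightarrow> real" where
  "moment p j = integral {-1..1} (\<lambda>t. t ^ j * rho p \<bar>t\<bar>)"

lemma rho_formula_tendsto_0:
  assumes "p > 1"
  shows "(rho_formula p \<longlongrightarrow> 0) (at_right 0)"
proof (rule Lim_null_comparison)
  define q where "q = hoelder_conj p"
  have q: "q > 1" "1 / q = 1 - 1 / p"
    using hoelder_conj_iff[OF assms, of q] by (auto simp: q_def)
  have bound: "norm (rho_formula p x) \<le> (x + x powr (1 / p)) powr (p - 1)"
    if x: "x > 0" "x < 1" for x
  proof -
    define y where "y = (1 / x - 1) powr (1 / q)"
    define w where "w = 1 - exp (\<i> * of_real (pi / q)) * of_real y"
    have y: "y \<ge> 0" "y \<le> x powr (1 / p - 1)"
    proof -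
      have "y \<le> (1 / x) powr (1 / q)"
        unfolding y_def using x q by (intro powr_mono2) (auto simp: field_simps)
      also have "\<dots> = x powr (1 / p - 1)"
        using x by (simp add: q(2) powr_divide powr_diff)
      finally show "y \<le> x powr (1 / p - 1)" .
    qed (simp add: y_def)
    have "norm w \<le> norm (1::complex) + norm (exp (\<i> * of_real (pi / q)) * of_real y)"
      unfolding w_def by (rule norm_triangle_ineq4)
    also have "\<dots> = 1 + y"
      using y by (simp add: norm_mult)
    finally have w: "norm w \<le> 1 + x powr (1 / p - 1)"
      using y by simp
    have "\<bar>rho_formula p x\<bar> = (1 / pi) * (x powr (p - 1) * \<bar>Im (w powr of_real (p - 1))\<bar>)"
      by (simp add: rho_formula_def w_def y_def q_def abs_mult)
    also have "\<dots> \<le> 1 * (x powr (p - 1) * \<bar>Im (w powr of_real (p - 1))\<bar>)"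
      using pi_gt3 by (intro mult_right_mono) auto
    also have "\<dots> \<le> x powr (p - 1) * norm (w powr of_real (p - 1))"
      using abs_Im_le_cmod by (auto intro!: mult_left_mono)
    also have "norm (w powr of_real (p - 1)) = norm w powr (p - 1)"
      using assms by (subst powr_principal_branch) (auto simp: norm_mult)
    also have "x powr (p - 1) * norm w powr (p - 1) = (x * norm w) powr (p - 1)"
      using x by (simp add: powr_mult)
    also have "\<dots> \<le> (x * (1 + x powr (1 / p - 1))) powr (p - 1)"
      using x w assms by (intro powr_mono2 mult_left_mono) auto
    also have "x * (1 + x powr (1 / p - 1)) = x + x powr (1 / p)"
      using x by (simp add: powr_diff field_simps)
    finally show ?thesis by simp
  qed
  show "\<forall>\<^sub>F x in at_right 0. norm (rho_formula p x) \<le> (x + x powr (1 / p)) powr (p - 1)"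
    using bound by (auto simp: eventually_at_right_field intro!: exI[of _ 1])
  have "((\<lambda>x. (x + x powr (1 / p)) powr (p - 1)) \<longlongrightarrow> (0 + 0 powr (1 / p)) powr (p - 1)) (at_right (0::real))"
    using assms
    by (intro tendsto_powr2 tendsto_add tendsto_ident_at tendsto_const)
       (auto simp: eventually_at_right_field intro!: exI[of _ 1])
  then show "((\<lambda>x. (x + x powr (1 / p)) powr (p - 1)) \<longlongrightarrow> 0) (at_right (0::real))"
    by simp
qed

lemma rho_0: "rho p 0 = 0" if "p > 1"
  using tendsto_Lim[OF _ rho_formula_tendsto_0[OF that]] by (simp add: rho_def)

lemma continuous_on_rho:
  assumes "p > 1"
  shows "continuous_on {0..1} (rho p)"
proof -
  define q where "q = hoelder_conj p"
  have q: "q > 1"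
    using hoelder_conj_iff[OF assms, of q] by (auto simp: q_def)
  have nonpos: "1 - exp (\<i> * of_real (pi / q)) * of_real ((1 / x - 1) powr (1 / q)) \<notin> \<real>\<^sub>\<le>\<^sub>0"
    if x: "x > 0" "x \<le> 1" for x
  proof (cases "x = 1")
    case False
    have "sin (pi / q) > 0"
      using q by (intro sin_gt_zero) (auto simp: field_simps)
    moreover have "(1 / x - 1) powr (1 / q) > 0"
      using False x by simp
    ultimately have "sin (pi / q) * (1 / x - 1) powr (1 / q) > 0"
      by (rule mult_pos_pos)
    then show ?thesis
      by (auto simp: complex_nonpos_Reals_iff Im_exp)
  qed simp
  have y: "continuous_on {0<..1} (\<lambda>x::real. (1 / x - 1) powr (1 / q))"
  proof (rule continuous_on_powr')
    show "\<forall>x\<in>{0<..1::real}. 1 / x - 1 \<ge> 0 \<and> (1 / x - 1 = 0 \<longrightarrow> 1 / q > 0)"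
      using q by auto
  qed (intro continuous_intros; simp)+
  define W where "W = (\<lambda>x::real. 1 - exp (\<i> * of_real (pi / q)) * of_real ((1 / x - 1) powr (1 / q)))"
  have "continuous_on {0<..1} W"
    unfolding W_def by (intro continuous_intros y)
  moreover have "{0<..1} \<subseteq> {x. Re (W x) \<ge> 0 \<or> Im (W x) \<noteq> 0}"
  proof
    fix x :: real assume "x \<in> {0<..1}"
    then have "W x \<notin> \<real>\<^sub>\<le>\<^sub>0"
      unfolding W_def by (intro nonpos) simp_all
    then show "x \<in> {x. Re (W x) \<ge> 0 \<or> Im (W x) \<noteq> 0}"
      by (auto simp: complex_nonpos_Reals_iff)
  qed
  ultimately have w: "continuous_on {0<..1} (\<lambda>x. W x powr of_real (p - 1))"
    using assms by (intro continuous_on_powr_complex continuous_on_const) simp_all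
  have A: "continuous_on {0<..1} (rho_formula p)"
  proof -
    have "rho_formula p = (\<lambda>x. - (1 / pi) * x powr (p - 1) * Im (W x powr of_real (p - 1)))"
      unfolding rho_formula_def W_def q_def by (rule refl ext)+
    moreover have "continuous_on {0<..1} (\<lambda>x::real. x powr (p - 1))"
      by (intro continuous_on_powr continuous_on_id continuous_on_const) auto
    ultimately show ?thesis
      using w by (simp only:) (intro continuous_on_mult continuous_on_const continuous_on_Im)
  qed
  have "continuous (at x within {0..1}) (rho p)" if x: "x \<in> {0..1}" for x
  proof (cases "x = 0")
    case True
    have "(rho p \<longlongrightarrow> 0) (at_right 0)"
      using rho_formula_tendsto_0[OF assms]
      by (rule Lim_transform_eventually) (auto simp: rho_def eventually_at_filter)
    then have "(rho p \<longlongrightarrow> 0) (at 0 within {0..1})"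
      by (simp add: at_within_Icc_at_right)
    then show ?thesis
      using True assms by (simp add: continuous_within rho_0)
  next
    case False
    have "continuous_on {0<..1} (rho p)"
      using A by (rule continuous_on_eq) (auto simp: rho_def)
    then have "continuous (at x within {0<..1}) (rho p)"
      using x False by (auto simp: continuous_on_eq_continuous_within)
    moreover have "at x within {0<..1} = at x within {0..1}"
      using x False by (intro at_within_nhd[of _ "{0<..}"]) auto
    ultimately show ?thesis
      by (simp add: continuous_within)
  qed
  then show ?thesis
    by (auto simp: continuous_on_eq_continuous_within)
qed

lemma moment_integrable:
  assumes "p > 1"
  shows "(\<lambda>t. t ^ j * rho p \<bar>t\<bar>) integrable_on {-1..1}"
  by (intro integrable_continuous_real continuous_intros
        continuous_on_compose2[OF continuous_on_rho[OF assms]]) auto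

lemma finite_compositions:
  "finite {rs :: nat list. length rs = n \<and> (\<forall>r \<in> set rs. r \<ge> 1) \<and> sum_list rs = s}"
proof (rule finite_subset)
  show "{rs :: nat list. length rs = n \<and> (\<forall>r \<in> set rs. r \<ge> 1) \<and> sum_list rs = s}
        \<subseteq> {rs. set rs \<subseteq> {..s} \<and> length rs = n}"
    using member_le_sum_list by auto
qed (simp add: finite_lists_length_eq)

end

theory Submission
  imports Defs "HOL-Complex_Analysis.Complex_Analysis"
begin

text \<open>
  Put \<open>G(z) = (z (1 - (1 - 1/z)\<^sup>1\<^sup>/\<^sup>q))\<^sup>p\<^sup>-\<^sup>1\<close>. It is holomorphic in the upper half plane
  and continuous up to the real axis, where it is real off \<open>[0,1]\<close> and has imaginary part
  \<open>-\<pi> \<rho>\<^sub>p\<close> on \<open>[0,1]\<close>. Applying Cauchy's theorem to \<open>z\<^sup>n G(z)\<close> on a large half disc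
  identifies the integral of \<open>x\<^sup>n \<rho>\<^sub>p(x)\<close> over \<open>[0,1]\<close> with the coefficient of \<open>1/z\<^sup>n\<^sup>+\<^sup>1\<close> in
  the real expansion of \<open>G\<close> at infinity. With \<open>w = 1/z\<close> this expansion is the binomial series of
  \<open>((1 - (1 - w)\<^sup>1\<^sup>/\<^sup>q) / w)\<^sup>p\<^sup>-\<^sup>1\<close>, and composing it with the series of the inner
  quotient gives the sum over compositions.
\<close>

section \<open>Power series: truncation error and coefficients of powers\<close>

text \<open>Induction on \<open>N\<close>: writing \<open>F\<close> as its constant term plus
  \<open>fps_X * G\<close>, each step gains one factor \<open>w\<close>. The base case is local
  boundedness from continuity at 0. The bound later controls the integrand on the large arc.\<close>

lemma has_fps_expansion_truncation_bound:
  fixes f :: "complex \<Rightarrow> complex"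
  assumes "f has_fps_expansion F"
  shows "\<exists>M. \<forall>\<^sub>F w in nhds 0. norm (f w - (\<Sum>j<N. fps_nth F j * w ^ j)) \<le> M * norm w ^ N"
  using assms
proof (induction N arbitrary: f F)
  case 0
  then have "isCont f 0"
    using has_fps_expansion_imp_continuous by blast
  then have "(f \<longlongrightarrow> f 0) (nhds 0)"
    by (simp add: continuous_at tendsto_at_iff_tendsto_nhds)
  then have "\<forall>\<^sub>F w in nhds 0. dist (f w) (f 0) < 1"
    by (auto dest!: tendstoD[where e = 1])
  then have "\<forall>\<^sub>F w in nhds 0. norm (f w) \<le> norm (f 0) + 1"
    by (rule eventually_mono) (smt (verit) dist_norm norm_triangle_sub)
  then show ?case by auto
next
  case (Suc N)
  define G where "G = fps_shift 1 F"
  have F: "F = fps_const (fps_nth F 0) + fps_X * G"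
    by (rule fps_ext) (simp add: G_def)
  have "fps_conv_radius G > 0"
    using Suc.prems by (simp add: G_def has_fps_expansion_def)
  then have G: "eval_fps G has_fps_expansion G"
    by (rule eval_fps_has_fps_expansion)
  have "(\<lambda>w. fps_nth F 0 + w * eval_fps G w) has_fps_expansion F"
    by (subst (2) F) (intro fps_expansion_intros G)
  with Suc.prems have eq: "\<forall>\<^sub>F w in nhds 0. f w = fps_nth F 0 + w * eval_fps G w"
    unfolding has_fps_expansion_def by (auto elim: eventually_elim2)
  obtain M where M: "\<forall>\<^sub>F w in nhds 0.
      norm (eval_fps G w - (\<Sum>j<N. fps_nth G j * w ^ j)) \<le> M * norm w ^ N"
    using Suc.IH[OF G] by blast
  have "\<forall>\<^sub>F w in nhds 0. norm (f w - (\<Sum>j<Suc N. fps_nth F j * w ^ j)) \<le> M * norm w ^ Suc N"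
    using eq M
  proof eventually_elim
    case (elim w)
    have "f w - (\<Sum>j<Suc N. fps_nth F j * w ^ j) =
        w * (eval_fps G w - (\<Sum>j<N. fps_nth G j * w ^ j))"
      by (subst sum.lessThan_Suc_shift)
         (simp add: elim(1) G_def sum_distrib_left algebra_simps)
    also have "norm \<dots> \<le> norm w * (M * norm w ^ N)"
      using elim(2) by (simp add: norm_mult mult_left_mono)
    finally show ?case by (simp add: mult_ac)
  qed
  then show ?case by blast
qed

text \<open>One more factor \<open>F\<close> prepends one part to the composition. The vanishing
  constant term removes parts equal to 0, which leaves finitely many compositions.\<close>

lemma fps_power_nth_compositions:
  fixes F :: "'a :: comm_ring_1 fps"
  assumes "fps_nth F 0 = 0"
  shows "fps_nth (F ^ n) s =
    (\<Sum>rs | length rs = n \<and> (\<forall>r \<in> set rs. r \<ge> 1) \<and> sum_list rs = s. \<Prod>r\<leftarrow>rs. fps_nth F r)"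
proof (induction n arbitrary: s)
  case 0
  have "{rs :: nat list. length rs = 0 \<and> (\<forall>r \<in> set rs. r \<ge> 1) \<and> sum_list rs = s} =
      (if s = 0 then {[]} else {})"
    by auto
  then show ?case by simp
next
  case (Suc n)
  define C where
    "C = (\<lambda>n s. {rs :: nat list. length rs = n \<and> (\<forall>r \<in> set rs. r \<ge> 1) \<and> sum_list rs = s})"
  have C: "C (Suc n) s = (\<lambda>(i, rs). i # rs) ` (SIGMA i : {1..s}. C n (s - i))"
    by (auto simp: C_def length_Suc_conv image_iff)
  have "fps_nth (F ^ Suc n) s = (\<Sum>i = 0..s. fps_nth F i * fps_nth (F ^ n) (s - i))"
    by (simp add: fps_mult_nth)
  also have "\<dots> = (\<Sum>i = 1..s. fps_nth F i * fps_nth (F ^ n) (s - i))"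
    using assms by (intro sum.mono_neutral_right) (auto simp: not_less_eq_eq)
  also have "\<dots> = (\<Sum>i = 1..s. \<Sum>rs \<in> C n (s - i). fps_nth F i * (\<Prod>r\<leftarrow>rs. fps_nth F r))"
    by (simp add: Suc.IH C_def sum_distrib_left)
  also have "\<dots> = (\<Sum>(i, rs) \<in> (SIGMA i : {1..s}. C n (s - i)).
      fps_nth F i * (\<Prod>r\<leftarrow>rs. fps_nth F r))"
    using finite_compositions by (intro sum.Sigma) (auto simp: C_def)
  also have "\<dots> = (\<Sum>rs \<in> C (Suc n) s. \<Prod>r\<leftarrow>rs. fps_nth F r)"
    unfolding C by (subst sum.reindex) (auto simp: inj_on_def intro!: sum.cong)
  finally show ?case unfolding C_def .
qed

section \<open>Cauchy's theorem on a large half disc\<close>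

text \<open>Over a half circle the cosines of nonzero integer frequency integrate to 0, whereas
  sines of odd frequency do not. Hence only the imaginary part of the arc integral isolates a single
  coefficient.\<close>

lemma has_integral_cos_of_int:
  "((\<lambda>t. cos (of_int m * t)) has_integral (if m = 0 then pi else 0)) {0..pi}"
proof (cases "m = 0")
  case True
  then show ?thesis using has_integral_const_real[of "1::real" 0 pi] by simp
next
  case False
  have "((\<lambda>t. cos (of_int m * t)) has_integral
      (sin (of_int m * pi) / of_int m - sin (of_int m * 0) / of_int m)) {0..pi}"
    using False
    by (intro fundamental_theorem_of_calculus)
       (auto intro!: derivative_eq_intros simp flip: has_real_derivative_iff_has_vector_derivative)
  moreover have "sin (of_int m * pi) = 0"
    by (simp add: sin_times_pi_eq_0)
  ultimately show ?thesis using False by simp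
qed

text \<open>This is the term z^(n-j) dz on the arc z = R cis t, where dz supplies the factor R i cis
  t. The frequency is 0 exactly for j = n + 1.\<close>

lemma cis_monomial:
  assumes "R > 0"
  shows "(of_real R * cis t) ^ n * inverse (of_real R * cis t) ^ j * of_real R * \<i> * cis t =
    of_real (R ^ n * inverse R ^ j * R) * (\<i> * cis (of_int (int n + 1 - int j) * t))"
proof -
  have "cis t ^ n * inverse (cis t) ^ j * cis t = cis (of_int (int n + 1 - int j) * t)"
    by (simp add: Complex.DeMoivre cis_mult algebra_simps)
  then show ?thesis
    by (simp add: power_mult_distrib mult_ac)
qed

text \<open>
  Only the coefficient of \<open>1/z\<close> contributes to the imaginary part of the
  integral over a large half circle.
\<close>
lemma integral_Im_upper_half_plane:
  fixes G H :: "complex \<Rightarrow> complex" and h :: "nat \<Rightarrow> real"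
  assumes cont: "continuous_on {z. Im z \<ge> 0} G"
    and holo: "G holomorphic_on {z. Im z > 0}"
    and real: "\<And>x. x \<notin> {0..1} \<Longrightarrow> Im (G (of_real x)) = 0"
    and F: "H has_fps_expansion F"
    and F_real: "\<And>j. fps_nth F j = of_real (h j)"
    and GH: "\<And>z. Im z \<ge> 0 \<Longrightarrow> norm z > 1 \<Longrightarrow> G z = H (inverse z)"
  shows "integral {0..1} (\<lambda>x. x ^ n * Im (G (of_real x))) = - pi * h (n + 1)"
proof -
  define f where "f z = z ^ n * G z" for z
  define L where "L = integral {0..1} (\<lambda>x. x ^ n * Im (G (of_real x)))"
  \<comment> \<open>The Laurent polynomial stops at j = n + 1, the 1/z term. The remainder is
    O(1/R^2) on the arc, which beats the arc length pi R.\<close>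
  define P where "P z = (\<Sum>j<n + 2. of_real (h j) * (z ^ n * inverse z ^ j))" for z :: complex
  have f_cont: "continuous_on {z. Im z \<ge> 0} f"
    unfolding f_def by (intro continuous_intros cont)
  have convex: "convex {z. Im z \<ge> 0}"
    using convex_halfspace_Im_ge[of 0] by simp
  have interior: "interior {z. Im z \<ge> 0} = {z. Im z > 0}"
    using interior_halfspace_ge[of \<i> 0] by simp
  have f_diff: "f field_differentiable at z" if "Im z > 0" for z
  proof -
    have "f holomorphic_on {z. Im z > 0}"
      unfolding f_def by (intro holomorphic_intros holo)
    then show ?thesis
      using that open_halfspace_Im_gt[of 0] by (auto intro: holomorphic_on_imp_differentiable_at)
  qed
  obtain M where "\<forall>\<^sub>F w in nhds 0.
      norm (H w - (\<Sum>j<n + 2. fps_nth F j * w ^ j)) \<le> M * norm w ^ (n + 2)"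
    using has_fps_expansion_truncation_bound[OF F] by blast
  then obtain d where d: "d > 0"
      "\<And>w. norm w < d \<Longrightarrow>
        norm (H w - (\<Sum>j<n + 2. of_real (h j) * w ^ j)) \<le> M * norm w ^ (n + 2)"
    by (auto simp: eventually_nhds_metric F_real)
  \<comment> \<open>\<open>R > 1\<close> puts [0,1] inside the diameter and makes \<open>GH\<close>
    available on the arc; \<open>R > 1 / d\<close> puts 1/z into the disc where the truncation bound
    holds.\<close>
  have bound: "\<bar>L + pi * h (n + 1)\<bar> \<le> \<bar>M\<bar> * pi / R" if R: "R > 1" "R > 1 / d" for R
  proof -
    define \<gamma> where "\<gamma> = part_circlepath 0 R 0 pi"
    have arc: "Im z \<ge> 0 \<and> norm z = R" if "z \<in> path_image \<gamma>" for z
    proof -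
      from that obtain t where t: "0 \<le> t" "t \<le> pi" "z = of_real R * cis t"
        using R by (auto simp: \<gamma>_def path_image_part_circlepath' closed_segment_eq_real_ivl)
      then show ?thesis
        using R sin_ge_zero[of t] by (auto simp: norm_mult)
    qed
    have "(f has_contour_integral 0) (linepath (of_real (- R)) (of_real R) +++ \<gamma>)"
    \<comment> \<open>The diameter lies on the boundary of the half plane, so the version needed
      asks for continuity on the closed convex set and differentiability only in its
      interior.\<close>
    proof (rule Cauchy_theorem_convex[OF f_cont convex, of "{}"])
      show "path_image (linepath (of_real (- R)) (of_real R) +++ \<gamma>) \<subseteq> {z. Im z \<ge> 0}"
      proof (rule subset_path_image_join)
        show "path_image (linepath (of_real (- R)) (of_real R)) \<subseteq> {z. 0 \<le> Im z}"
          using closed_segment_subset[OF _ _ convex, of "of_real (- R)" "of_real R"] by auto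
      qed (use arc in auto)
    qed (use interior f_diff R in \<open>auto simp: \<gamma>_def intro!: valid_path_join\<close>)
    moreover have f_arc: "f contour_integrable_on \<gamma>"
      unfolding \<gamma>_def using arc
      by (intro contour_integrable_continuous_part_circlepath continuous_on_subset[OF f_cont])
         (auto simp: \<gamma>_def)
    moreover have f_line: "f contour_integrable_on linepath (of_real (- R)) (of_real R)"
      using closed_segment_subset[OF _ _ convex, of "of_real (- R)" "of_real R"]
      by (intro contour_integrable_continuous_linepath continuous_on_subset[OF f_cont]) auto
    ultimately have sum0: "contour_integral (linepath (of_real (- R)) (of_real R)) f +
        contour_integral \<gamma> f = 0"
      by (metis \<gamma>_def contour_integral_join contour_integral_unique valid_path_linepath
          valid_path_part_circlepath)
    have "(f has_contour_integral contour_integral (linepath (of_real (- R)) (of_real R)) f)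
        (linepath (of_real (- R)) (of_real R))"
      using f_line by (rule has_contour_integral_integral)
    then have "((\<lambda>x. f (of_real x)) has_integral
        contour_integral (linepath (of_real (- R)) (of_real R)) f) {- R..R}"
      using R by (subst (asm) has_contour_integral_linepath_Reals_iff) auto
    from has_integral_linear[OF this bounded_linear_Im]
    have "((\<lambda>x. x ^ n * Im (G (of_real x))) has_integral
        Im (contour_integral (linepath (of_real (- R)) (of_real R)) f)) {- R..R}"
      by (simp add: o_def f_def flip: of_real_power)
    \<comment> \<open>By \<open>real\<close> the integrand vanishes on the diameter outside
      [0,1].\<close>
    moreover have "((\<lambda>x. x ^ n * Im (G (of_real x))) has_integral L) {- R..R}"
    proof (rule has_integral_on_superset)
      have "continuous_on {0..1} (\<lambda>x. G (of_real x))"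
        by (intro continuous_on_compose2[OF cont] continuous_intros) auto
      then have "(\<lambda>x. x ^ n * Im (G (of_real x))) integrable_on {0..1}"
        by (intro integrable_continuous_real continuous_intros)
      then show "((\<lambda>x. x ^ n * Im (G (of_real x))) has_integral L) {0..1}"
        unfolding L_def by (rule integrable_integral)
    qed (use R real in auto)
    ultimately have line: "Im (contour_integral (linepath (of_real (- R)) (of_real R)) f) = L"
      using has_integral_unique by blast
    have P_arc: "P contour_integrable_on \<gamma>"
      unfolding \<gamma>_def P_def using arc R
      by (intro contour_integrable_continuous_part_circlepath continuous_intros)
         (use arc[of 0] in \<open>auto simp: \<gamma>_def\<close>)
    then have "(P has_contour_integral contour_integral \<gamma> P) (part_circlepath 0 R 0 pi)"
      unfolding \<gamma>_def by (rule has_contour_integral_integral)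
    then have "((\<lambda>t. P (0 + R * cis t) * R * \<i> * cis t) has_integral contour_integral \<gamma> P) {0..pi}"
      by (subst (asm) has_contour_integral_part_circlepath_iff) auto
    from has_integral_linear[OF this bounded_linear_Im]
    have "((\<lambda>t. \<Sum>j<n + 2. h j * (R ^ n * inverse R ^ j * R) * cos (of_int (int n + 1 - int j) * t))
        has_integral Im (contour_integral \<gamma> P)) {0..pi}"
    proof (rule has_integral_eq[rotated])
      have Im_term: "Im (of_real u * (of_real v * (\<i> * cis s))) = u * v * cos s" for u v s
        by simp
      fix t :: real
      have "P (R * cis t) * R * \<i> * cis t = (\<Sum>j<n + 2. of_real (h j) *
          ((of_real R * cis t) ^ n * inverse (of_real R * cis t) ^ j * of_real R * \<i> * cis t))"
        by (simp only: P_def sum_distrib_right mult.assoc)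
      also have "\<dots> = (\<Sum>j<n + 2. of_real (h j) *
          (of_real (R ^ n * inverse R ^ j * R) * (\<i> * cis (of_int (int n + 1 - int j) * t))))"
        using R by (subst cis_monomial) auto
      finally have "Im (P (R * cis t) * R * \<i> * cis t) = (\<Sum>j<n + 2. Im (of_real (h j) *
          (of_real (R ^ n * inverse R ^ j * R) * (\<i> * cis (of_int (int n + 1 - int j) * t)))))"
        by (simp only: Im_sum)
      also have "\<dots> = (\<Sum>j<n + 2. h j * (R ^ n * inverse R ^ j * R) *
          cos (of_int (int n + 1 - int j) * t))"
        by (intro sum.cong refl) (rule Im_term)
      finally show "(Im \<circ> (\<lambda>t. P (0 + R * cis t) * R * \<i> * cis t)) t =
          (\<Sum>j<n + 2. h j * (R ^ n * inverse R ^ j * R) *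
            cos (of_int (int n + 1 - int j) * t))"
        by simp
    qed
    moreover have "((\<lambda>t. \<Sum>j<n + 2. h j * (R ^ n * inverse R ^ j * R) *
        cos (of_int (int n + 1 - int j) * t)) has_integral
        (\<Sum>j<n + 2. h j * (R ^ n * inverse R ^ j * R) * (if int n + 1 - int j = 0 then pi else 0)))
        {0..pi}"
      by (intro has_integral_sum has_integral_mult_right has_integral_cos_of_int) auto
    ultimately have "Im (contour_integral \<gamma> P) =
        (\<Sum>j<n + 2. h j * (R ^ n * inverse R ^ j * R) * (if int n + 1 - int j = 0 then pi else 0))"
      using has_integral_unique by blast
    \<comment> \<open>For j = n + 1 the powers of \<open>R\<close> cancel, so the surviving term
      does not depend on the radius.\<close>
    also have "\<dots> = (\<Sum>j<n + 2. if j = n + 1 then pi * h (n + 1) else 0)"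
      using R by (intro sum.cong) (auto simp: field_simps)
    also have "\<dots> = pi * h (n + 1)"
      by simp
    finally have P_Im: "Im (contour_integral \<gamma> P) = pi * h (n + 1)" .
    have "norm (contour_integral \<gamma> (\<lambda>z. f z - P z)) \<le> (\<bar>M\<bar> / R ^ 2) * R * \<bar>pi - 0\<bar>"
      unfolding \<gamma>_def
    proof (rule contour_integral_bound_part_circlepath)
      show "(\<lambda>z. f z - P z) contour_integrable_on part_circlepath 0 R 0 pi"
        using f_arc P_arc by (auto simp: \<gamma>_def intro: contour_integrable_diff)
      fix z assume "z \<in> path_image (part_circlepath 0 R 0 pi)"
      then have z: "Im z \<ge> 0" "norm z = R"
        using arc by (auto simp: \<gamma>_def)
      have "f z - P z = z ^ n * (H (inverse z) - (\<Sum>j<n + 2. of_real (h j) * inverse z ^ j))"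
        using GH[of z] z R
        by (simp add: f_def P_def sum_distrib_left ring_distribs mult_ac)
      also have "norm \<dots> \<le> R ^ n * (M * inverse R ^ (n + 2))"
      proof -
        have "norm (inverse z) < d"
          using z R d(1) by (simp add: norm_divide field_simps)
        then have "norm (H (inverse z) - (\<Sum>j<n + 2. of_real (h j) * inverse z ^ j)) \<le>
            M * inverse R ^ (n + 2)"
          using d(2)[of "inverse z"] z by (simp only: norm_inverse)
        then show ?thesis
          unfolding norm_mult norm_power z(2) using R by (intro mult_left_mono) auto
      qed
      also have "\<dots> = M / R ^ 2"
        using R by (simp add: field_simps power_add power2_eq_square)
      also have "\<dots> \<le> \<bar>M\<bar> / R ^ 2"
        by (intro divide_right_mono) auto
      finally show "norm (f z - P z) \<le> \<bar>M\<bar> / R ^ 2" .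
    qed (use R in auto)
    also have "\<dots> = \<bar>M\<bar> * pi / R"
      using R by (simp add: field_simps power2_eq_square)
    finally have "\<bar>Im (contour_integral \<gamma> (\<lambda>z. f z - P z))\<bar> \<le> \<bar>M\<bar> * pi / R"
      using abs_Im_le_cmod order_trans by blast
    moreover have "Im (contour_integral \<gamma> f) = - L"
      using arg_cong[OF sum0, of Im] line by simp
    ultimately show ?thesis
      using P_Im f_arc P_arc by (simp add: contour_integral_diff abs_minus_commute)
  qed
  have "\<bar>L + pi * h (n + 1)\<bar> \<le> 0"
  proof (rule tendsto_lowerbound)
    show "((\<lambda>R. \<bar>M\<bar> * pi / R) \<longlongrightarrow> 0) at_top"
      by (rule tendsto_divide_0[OF tendsto_const filterlim_at_top_imp_at_infinity[OF filterlim_ident]])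
    show "\<forall>\<^sub>F R in at_top. \<bar>L + pi * h (n + 1)\<bar> \<le> \<bar>M\<bar> * pi / R"
      using eventually_gt_at_top[of 1] eventually_gt_at_top[of "1 / d"]
      by eventually_elim (rule bound)
  qed simp
  then show ?thesis by (simp add: L_def)
qed


section \<open>The base function on the closed upper half plane\<close>

text \<open>Strict concavity of sine on [0, \<pi>]: the mean value theorem on each side of the
  intermediate point \<open>m\<close> gives slopes cos u and cos v with u < v, and cosine is
  strictly decreasing there.\<close>

lemma sin_convex_combination_less:
  fixes a b x y :: real
  assumes "a > 0" "b > 0" "a + b = 1" "0 \<le> x" "x < y" "y \<le> pi"
  shows "a * sin x + b * sin y < sin (a * x + b * y)"
proof -
  define m where "m = a * x + b * y"
  have m: "m - x = b * (y - x)" "y - m = a * (y - x)"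
  proof -
    have a: "a = 1 - b"
      using assms by simp
    show "m - x = b * (y - x)" "y - m = a * (y - x)"
      unfolding m_def a by (simp_all add: algebra_simps)
  qed
  have "m - x > 0" "y - m > 0"
    unfolding m using assms by auto
  then have less: "x < m" "m < y" by auto
  have "\<exists>u>x. u < m \<and> sin m - sin x = (m - x) * cos u"
    using less by (intro MVT2) (auto intro!: derivative_eq_intros)
  then obtain u where u: "x < u" "u < m" "sin m - sin x = (m - x) * cos u" by blast
  have "\<exists>v>m. v < y \<and> sin y - sin m = (y - m) * cos v"
    using less by (intro MVT2) (auto intro!: derivative_eq_intros)
  then obtain v where v: "m < v" "v < y" "sin y - sin m = (y - m) * cos v" by blast
  have "cos v < cos u"
    using u v assms by (intro cos_monotone_0_pi) auto
  then have "a * b * (y - x) * cos v < a * b * (y - x) * cos u"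
    using assms by simp
  then have "b * (sin y - sin m) < a * (sin m - sin x)"
    unfolding u(3) v(3) m by (simp add: mult_ac)
  then have "a * sin x + b * sin y < (a + b) * sin m"
    by (simp add: algebra_simps)
  then show ?thesis
    using assms by (simp add: m_def)
qed

text \<open>The principal branch takes Arg = \<pi> on the negative axis, which is the limit from
  above. Multiplication by -i rotates the domain into the closed right half plane, away from the
  cut; c > 0 gives continuity at 0.\<close>

lemma continuous_on_powr_upper_half_plane:
  fixes c :: real
  assumes "c > 0"
  shows "continuous_on {z. Im z \<ge> 0} (\<lambda>z. z powr of_real c)"
proof -
  have "continuous_on {z. Im z \<ge> 0}
      (\<lambda>z. exp (\<i> * of_real (pi / 2 * c)) * (- \<i> * z) powr of_real c)"
    using assms by (intro continuous_intros) auto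
  moreover have eq: "exp (\<i> * of_real (pi / 2 * c)) * (- \<i> * z) powr of_real c = z powr of_real c"
    if "Im z \<ge> 0" for z
  proof (cases "z = 0")
    case False
    have "Ln z = Ln (- (\<i> * z)) + \<i> * of_real (pi / 2)"
      using Ln_times_ii[of "- \<i> * z"] False that
      by (auto split: if_splits)
    then show ?thesis
      using False by (simp add: powr_def distrib_left add.commute mult_ac flip: exp_add)
  qed simp
  ultimately show ?thesis
    by (rule continuous_on_eq) (simp only: mem_Collect_eq eq)
qed

text \<open>
  Equals \<open>z (1 - (1 - 1/z)\<^sup>1\<^sup>/\<^sup>q)\<close> in the open upper half plane; unlike that
  expression, with principal powers it is continuous up to the whole real axis, including \<open>0\<close>.
\<close>
definition rho_base :: "real \<Rightarrow> complex \<Rightarrow> complex" where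
  "rho_base p z = z - z powr of_real (1 / p) * (z - 1) powr of_real (1 - 1 / p)"

lemma continuous_on_rho_base:
  assumes "p > 1"
  shows "continuous_on {z. Im z \<ge> 0} (rho_base p)"
proof -
  have shift: "continuous_on {z. Im z \<ge> 0} (\<lambda>z. (z - 1) powr of_real (1 - 1 / p))"
    using assms
    by (intro continuous_on_compose2[OF continuous_on_powr_upper_half_plane] continuous_intros) auto
  show ?thesis
    unfolding rho_base_def
    by (intro continuous_on_diff continuous_on_mult continuous_on_id
        continuous_on_powr_upper_half_plane shift) (use assms in auto)
qed

lemma holomorphic_on_rho_base: "rho_base p holomorphic_on {z. Im z > 0}"
  unfolding rho_base_def
  by (intro holomorphic_intros) (auto simp: complex_nonpos_Reals_iff)

text \<open>
  With \<open>a = 1/p\<close>, \<open>b = 1/q\<close>, \<open>\<theta> = Arg z\<close> and \<open>\<phi> = Arg (z - 1)\<close>, the claim reduces to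
  \<open>sin\<^sup>a \<theta> sin\<^sup>b \<phi> < sin (a \<theta> + b \<phi>)\<close>, by weighted AM-GM and concavity of \<open>sin\<close>.
\<close>
lemma Im_rho_base_neg:
  assumes "p > 1" "Im z > 0"
  shows "Im (rho_base p z) < 0"
proof -
  define a b where "a = 1 / p" and "b = 1 - 1 / p"
  have ab: "a > 0" "b > 0" "a + b = 1"
    using assms by (auto simp: a_def b_def)
  have nz: "z \<noteq> 0" "z - 1 \<noteq> 0"
    using assms by auto
  define \<theta> \<phi> where "\<theta> = Arg z" and "\<phi> = Arg (z - 1)"
  have range: "0 < \<theta>" "\<theta> < pi" "0 < \<phi>" "\<phi> < pi"
    using Arg_lt_pi[of z] Arg_lt_pi[of "z - 1"] assms by (auto simp: \<theta>_def \<phi>_def)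
  have z: "z = of_real (norm z) * cis \<theta>" "z - 1 = of_real (norm (z - 1)) * cis \<phi>"
    using rcis_cmod_Arg[of z] rcis_cmod_Arg[of "z - 1"] by (simp_all add: rcis_def \<theta>_def \<phi>_def)
  have Im1: "Im z = norm z * sin \<theta>"
    using arg_cong[OF z(1), of Im] by simp
  have Im2: "Im z = norm (z - 1) * sin \<phi>"
    using arg_cong[OF z(2), of Im] by simp
  \<comment> \<open>Strict concavity needs distinct arguments. Equal ones, with the common imaginary
    part, would force equal moduli and hence z = z - 1.\<close>
  have "\<theta> \<noteq> \<phi>"
  proof
    assume "\<theta> = \<phi>"
    then have "norm z = norm (z - 1)"
      using Im1 Im2 range sin_gt_zero[of \<phi>] by simp
    then show False
      using z \<open>\<theta> = \<phi>\<close> by simp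
  qed
  then have "a * sin \<theta> + b * sin \<phi> < sin (a * \<theta> + b * \<phi>)"
    using sin_convex_combination_less[of a b \<theta> \<phi>] sin_convex_combination_less[of b a \<phi> \<theta>] ab range
    by (cases "\<theta> < \<phi>") (auto simp: add.commute)
  moreover have "sin \<theta> powr a * sin \<phi> powr b \<le> a * sin \<theta> + b * sin \<phi>"
    using range ab by (intro Youngs_inequality_0) (auto intro: sin_gt_zero)
  ultimately have less: "sin \<theta> powr a * sin \<phi> powr b < sin (a * \<theta> + b * \<phi>)"
    by simp
  \<comment> \<open>Since \<open>z\<close> and \<open>z - 1\<close> have the same imaginary part and
    a + b = 1, one factor can be expressed through each polar form.\<close>
  have "Im z = Im z powr a * Im z powr b"
    using assms ab by (simp flip: powr_add)
  also have "\<dots> = (norm z * sin \<theta>) powr a * (norm (z - 1) * sin \<phi>) powr b"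
    using Im1 Im2 by simp
  also have "\<dots> = norm z powr a * norm (z - 1) powr b * (sin \<theta> powr a * sin \<phi> powr b)"
    using range by (simp add: powr_mult sin_ge_zero)
  also have "\<dots> < norm z powr a * norm (z - 1) powr b * sin (a * \<theta> + b * \<phi>)"
    using less nz by (intro mult_strict_left_mono mult_pos_pos) auto
  also have "\<dots> = Im (z powr of_real a * (z - 1) powr of_real b)"
  proof -
    have "z powr of_real a * (z - 1) powr of_real b =
        of_real (norm z powr a * norm (z - 1) powr b) * cis (a * \<theta> + b * \<phi>)"
      using ab by (simp add: powr_principal_branch \<theta>_def \<phi>_def cis_mult cis_conv_exp exp_add
          ring_distribs)
    then show ?thesis by simp
  qed
  finally show ?thesis
    by (simp add: rho_base_def a_def b_def)
qed

text \<open>For x < 0 the phases of the two powers multiply to e^(i\<pi>) = -1; for x \<ge> 1 both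
  powers are real. The sign follows from |x| = |x|^a |x|^b and monotonicity of \<open>powr\<close>.
  Consequently the outer power is real there.\<close>

lemma rho_base_of_real_outside:
  assumes "p > 1" "x \<notin> {0<..<1}"
  shows "\<exists>t\<ge>0. rho_base p (of_real x) = of_real t"
proof -
  define a b where "a = 1 / p" and "b = 1 - 1 / p"
  have ab: "a > 0" "b > 0" "a + b = 1"
    using assms by (auto simp: a_def b_def)
  consider "x = 0" | "x < 0" | "x \<ge> 1"
    using assms by fastforce
  then show ?thesis
  proof cases
    case 1
    then show ?thesis by (auto simp: rho_base_def)
  next
    case 2
    define y where "y = - x"
    have y: "y > 0" using 2 by (simp add: y_def)
    have "rho_base p (of_real x) = of_real x - of_real (y powr a * (y + 1) powr b) *
        (exp (\<i> * pi * a) * exp (\<i> * pi * b))"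
      using 2 powr_of_neg_real[of x a] powr_of_neg_real[of "x - 1" b]
      by (simp add: rho_base_def a_def b_def y_def)
    also have "exp (\<i> * pi * a) * exp (\<i> * pi * b) = - 1"
    proof -
      have "exp (\<i> * pi * a) * exp (\<i> * pi * b) = exp (\<i> * pi * of_real (a + b))"
        by (simp add: ring_distribs flip: exp_add)
      then show ?thesis using ab by simp
    qed
    finally have "rho_base p (of_real x) = of_real (y powr a * (y + 1) powr b - y)"
      by (simp add: y_def)
    moreover have "y = y powr a * y powr b"
      using y ab by (simp flip: powr_add)
    moreover have "y powr a * y powr b \<le> y powr a * (y + 1) powr b"
      using y ab by (intro mult_left_mono powr_mono2) auto
    ultimately show ?thesis
      by (intro exI[of _ "y powr a * (y + 1) powr b - y"]) auto
  next
    case 3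
    have "of_real x powr of_real a = complex_of_real (x powr a)"
      using 3 by (intro powr_of_real) auto
    moreover have "(of_real x - 1) powr of_real b = complex_of_real ((x - 1) powr b)"
      using 3 powr_of_real[of "x - 1" b] by simp
    ultimately have "rho_base p (of_real x) = of_real (x - x powr a * (x - 1) powr b)"
      by (simp add: rho_base_def a_def b_def)
    moreover have "x = x powr a * x powr b"
      using 3 ab by (simp flip: powr_add)
    moreover have "x powr a * (x - 1) powr b \<le> x powr a * x powr b"
      using 3 ab by (intro mult_left_mono powr_mono2) auto
    ultimately show ?thesis
      by (intro exI[of _ "x - x powr a * (x - 1) powr b"]) auto
  qed
qed

text \<open>The negative number x - 1 contributes the phase e^(i\<pi>(1-1/p)); extracting x from the
  moduli then produces the base that occurs in \<open>rho_formula\<close>.\<close>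

lemma rho_base_of_real_inside:
  assumes "p > 1" "0 < x" "x \<le> 1"
  shows "rho_base p (of_real x) = of_real x *
    (1 - exp (\<i> * of_real (pi * (1 - 1 / p))) * of_real ((1 / x - 1) powr (1 - 1 / p)))"
proof (cases "x = 1")
  case True
  then show ?thesis by (simp add: rho_base_def)
next
  case False
  have x: "(1 - x) powr (1 - 1 / p) = x powr (1 - 1 / p) * (1 / x - 1) powr (1 - 1 / p)"
  proof -
    have "1 - x = x * (1 / x - 1)"
      using assms by (simp add: right_diff_distrib)
    then have "(1 - x) powr (1 - 1 / p) = (x * (1 / x - 1)) powr (1 - 1 / p)"
      by (rule arg_cong)
    then show ?thesis
      using assms by (simp only: powr_mult)
  qed
  have "x powr (1 / p) * (1 - x) powr (1 - 1 / p) =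
      x powr (1 / p + (1 - 1 / p)) * (1 / x - 1) powr (1 - 1 / p)"
    unfolding x powr_add by simp
  then have "x powr (1 / p) * (1 - x) powr (1 - 1 / p) = x * (1 / x - 1) powr (1 - 1 / p)"
    using assms by simp
  moreover have "of_real x powr of_real (1 / p) = complex_of_real (x powr (1 / p))"
    using assms by (intro powr_of_real) auto
  moreover have "(of_real x - 1) powr of_real (1 - 1 / p) =
      of_real ((1 - x) powr (1 - 1 / p)) * exp (\<i> * of_real (pi * (1 - 1 / p)))"
    using False assms powr_of_neg_real[of "x - 1" "1 - 1 / p"] by (simp add: mult_ac)
  ultimately show ?thesis
    by (simp add: rho_base_def algebra_simps flip: of_real_mult)
qed

lemma Im_rho_base_of_real_inside:
  assumes "p > 1" "0 < x" "x < 1"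
  shows "Im (rho_base p (of_real x)) < 0"
proof -
  have "sin (pi * (1 - 1 / p)) > 0"
    using assms by (intro sin_gt_zero) (auto simp: field_simps)
  moreover have "(1 / x - 1) powr (1 - 1 / p) > 0"
    using assms by simp
  ultimately show ?thesis
    using assms by (simp add: rho_base_of_real_inside Im_exp)
qed

text \<open>This is the condition under which the outer principal power is continuous. It combines
  the strictly negative imaginary part, in the open half plane and on (0,1), with nonnegative real
  values on the rest of the axis.\<close>

lemma rho_base_avoids_negative_reals:
  assumes "p > 1" "Im z \<ge> 0"
  shows "Re (rho_base p z) \<ge> 0 \<or> Im (rho_base p z) \<noteq> 0"
proof (cases "Im z = 0")
  case True
  then have z: "z = of_real (Re z)"
    by (simp add: complex_eq_iff)
  show ?thesis
  proof (cases "Re z \<in> {0<..<1}")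
    case True
    then show ?thesis
      using Im_rho_base_of_real_inside[OF assms(1), of "Re z"] z by auto
  next
    case False
    then show ?thesis
      using rho_base_of_real_outside[OF assms(1) False] z by auto
  qed
next
  case False
  then show ?thesis
    using Im_rho_base_neg[OF assms(1), of z] assms by auto
qed

section \<open>The power series at infinity\<close>

text \<open>The value at 0 fills the removable singularity. With b = 1 - 1/p and w = 1/z this is the
  base function near infinity.\<close>

definition binomial_quotient :: "real \<Rightarrow> complex \<Rightarrow> complex" where
  "binomial_quotient b w = (if w = 0 then of_real b else (1 - (1 - w) powr of_real b) / w)"

text \<open>The binomial series of (1 - w)^b has coefficients (-b)_r / r!, and (-b)_(r+1) = -b
  (1-b)_r; subtracting from 1 and dividing by w shifts the index by one.\<close>

lemma binomial_quotient_has_fps_expansion: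
  assumes "b \<noteq> 0"
  shows "binomial_quotient b has_fps_expansion
     Abs_fps (\<lambda>r. of_real (b * pochhammer (1 - b) r / fact (r + 1)))"
proof -
  define B where "B = fps_binomial (complex_of_real b) oo (- fps_X)"
  have B_nth: "fps_nth B r = of_real (pochhammer (- b) r / fact r)" for r
    by (simp add: B_def fps_compose_uminus' gbinomial_pochhammer pochhammer_of_real
        flip: of_real_minus power_mult_distrib mult.assoc)
  have B: "(\<lambda>w. (1 - w) powr of_real b) has_fps_expansion B"
  proof -
    have "((\<lambda>x. (1 + x) powr complex_of_real b) \<circ> (\<lambda>w. - w)) has_fps_expansion B"
      unfolding B_def by (intro fps_expansion_intros) auto
    then show ?thesis by (simp add: o_def)
  qed
  have "(\<lambda>w. if w = 0 then of_real b else (1 - (1 - w) powr of_real b) / w ^ 1)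
      has_fps_expansion fps_shift 1 (1 - B)"
  proof (rule has_fps_expansion_shift)
    show "(\<lambda>w. 1 - (1 - w) powr of_real b) has_fps_expansion 1 - B"
      by (intro fps_expansion_intros B)
    \<comment> \<open>The linear coefficient is b. It rules out the zero series, whose
      \<open>subdegree\<close> is 0 by convention.\<close>
    have "fps_nth (1 - B) 1 \<noteq> 0"
      using assms by (simp add: B_nth)
    then have "1 - B \<noteq> 0"
      by (metis fps_zero_nth)
    then show "1 \<le> subdegree (1 - B)"
      by (rule subdegree_geI) (simp add: B_nth)
  qed (simp add: B_nth)
  moreover have "fps_shift 1 (1 - B) = Abs_fps (\<lambda>r. of_real (b * pochhammer (1 - b) r / fact (r + 1)))"
    by (rule fps_ext) (simp add: B_nth pochhammer_rec add.commute)
  ultimately show ?thesis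
    by (simp only: binomial_quotient_def[abs_def] power_one_right)
qed

text \<open>The normalized quotient minus 1, with b = 1 - 1/p: the general formula would give 1 at r
  = 0, and setting it to 0 permits composition with the binomial series.\<close>

definition root_series :: "real \<Rightarrow> complex fps" where
  "root_series p =
     Abs_fps (\<lambda>r. if r = 0 then 0 else of_real (pochhammer (1 / p) r / fact (r + 1)))"

text \<open>The coefficient of w^j in the (p-1)-th power of the quotient. The range from 0 to j is
  that of the coefficient formula for composed series.\<close>

definition moment_coeff :: "real \<Rightarrow> nat \<Rightarrow> real" where
  "moment_coeff p j = ((p - 1) / p) powr (p - 1) * (\<Sum>n = 0..j. ((p - 1) gchoose n) *
     (\<Sum>rs | length rs = n \<and> (\<forall>r \<in> set rs. r \<ge> 1) \<and> sum_list rs = j.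
       \<Prod>r\<leftarrow>rs. pochhammer (1 / p) r / fact (r + 1)))"

text \<open>The quotient is b (1 + s) with s(0) = 0. As b is a positive real, the principal power
  splits: b^(p-1) is the prefactor and (1 + s)^(p-1) is the binomial series composed with that of
  s.\<close>

lemma binomial_quotient_powr_has_fps_expansion:
  assumes "p > 1"
  shows "(\<lambda>w. binomial_quotient (1 - 1 / p) w powr of_real (p - 1)) has_fps_expansion
    Abs_fps (\<lambda>j. of_real (moment_coeff p j))"
proof -
  define b where "b = 1 - 1 / p"
  have b: "b > 0" "b = (p - 1) / p" "1 - b = 1 / p"
    using assms by (auto simp: b_def field_simps)
  define s where "s w = of_real (1 / b) * binomial_quotient b w - 1" for w
  have "s has_fps_expansion fps_const (of_real (1 / b)) *
      Abs_fps (\<lambda>r. of_real (b * pochhammer (1 - b) r / fact (r + 1))) - 1"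
    unfolding s_def using b
    by (intro fps_expansion_intros binomial_quotient_has_fps_expansion) auto
  also have "fps_const (of_real (1 / b)) *
      Abs_fps (\<lambda>r. of_real (b * pochhammer (1 - b) r / fact (r + 1))) - 1 = root_series p"
    using b(1) by (intro fps_ext) (simp add: root_series_def b(3))
  finally have s: "s has_fps_expansion root_series p" .
  have "((\<lambda>x. (1 + x) powr of_real (p - 1)) \<circ> s) has_fps_expansion
      (fps_binomial (of_real (p - 1)) oo root_series p)"
    by (intro has_fps_expansion_compose has_fps_expansion_binomial_complex s)
       (simp add: root_series_def)
  then have "(\<lambda>w. of_real b powr of_real (p - 1) * (1 + s w) powr of_real (p - 1)) has_fps_expansion
      fps_const (of_real b powr of_real (p - 1)) * (fps_binomial (of_real (p - 1)) oo root_series p)"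
    unfolding o_def by (rule has_fps_expansion_cmult_left)
  also have "(\<lambda>w. of_real b powr of_real (p - 1) * (1 + s w) powr of_real (p - 1)) =
      (\<lambda>w. binomial_quotient b w powr of_real (p - 1))"
  proof
    fix w
    have "of_real b * (1 + s w) = binomial_quotient b w"
      using b(1) by (simp add: s_def)
    then show "of_real b powr of_real (p - 1) * (1 + s w) powr of_real (p - 1) =
        binomial_quotient b w powr of_real (p - 1)"
      using b powr_times_real_left[of "of_real b" "1 + s w" "of_real (p - 1)"] by simp
  qed
  also have "fps_const (of_real b powr of_real (p - 1)) *
      (fps_binomial (of_real (p - 1)) oo root_series p) = Abs_fps (\<lambda>j. of_real (moment_coeff p j))"
  proof (rule fps_ext)
    fix j
    have power: "fps_nth (root_series p ^ n) j = of_real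
        (\<Sum>rs | length rs = n \<and> (\<forall>r \<in> set rs. r \<ge> 1) \<and> sum_list rs = j.
          \<Prod>r\<leftarrow>rs. pochhammer (1 / p) r / fact (r + 1))" for n
    proof -
      have prod: "(\<Prod>r\<leftarrow>rs. fps_nth (root_series p) r) =
          of_real (\<Prod>r\<leftarrow>rs. pochhammer (1 / p) r / fact (r + 1))"
        if "\<forall>r \<in> set rs. r \<ge> 1" for rs
        using that by (induction rs) (auto simp: root_series_def)
      have "fps_nth (root_series p) 0 = 0"
        by (simp add: root_series_def)
      then show ?thesis
        unfolding of_real_sum
        by (subst fps_power_nth_compositions)
           (assumption, intro sum.cong refl prod, simp)
    qed
    have gchoose: "of_real (p - 1) gchoose n = complex_of_real ((p - 1) gchoose n)" for n
      by (simp add: gbinomial_prod_rev)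
    have "of_real b powr of_real (p - 1) = complex_of_real (b powr (p - 1))"
      using b by (intro powr_of_real) auto
    then show "fps_nth (fps_const (of_real b powr of_real (p - 1)) *
        (fps_binomial (of_real (p - 1)) oo root_series p)) j =
        fps_nth (Abs_fps (\<lambda>j. of_real (moment_coeff p j))) j"
      by (simp only: fps_mult_left_const_nth fps_compose_nth fps_binomial_nth power gchoose
          fps_nth_Abs_fps moment_coeff_def b(2) of_real_mult of_real_sum)
  qed
  finally show ?thesis
    by (simp add: b_def)
qed

section \<open>Matching the branches and evaluating the moments\<close>

lemma rho_base_eq_binomial_quotient:
  assumes "Im z \<ge> 0" "norm z > 1"
  shows "rho_base p z = binomial_quotient (1 - 1 / p) (inverse z)"
proof -
  define u where "u = 1 - inverse z"
  have z: "z \<noteq> 0" "z \<noteq> 1" using assms by auto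
  then have u: "u \<noteq> 0" "z - 1 = z * u"
    by (auto simp: u_def field_simps)
  have "Re (inverse z) < 1"
  proof -
    have "norm (inverse z) < 1"
      using assms by (simp add: norm_inverse inverse_less_1_iff)
    then show ?thesis
      using complex_Re_le_cmod[of "inverse z"] by linarith
  qed
  then have "Re u > 0"
    by (simp add: u_def)
  then have Arg_u: "\<bar>Im (Ln u)\<bar> < pi / 2"
    using Re_Ln_pos_lt[OF u(1)] by simp
  have Arg_z: "0 \<le> Im (Ln z)" "Im (Ln z) \<le> pi"
    using assms z Im_Ln_pos_le[of z] by auto
  have Arg_z1: "0 \<le> Im (Ln (z - 1))"
    using assms z Im_Ln_pos_le[of "z - 1"] by auto
  \<comment> \<open>The arguments of z and u add up to a value in (-\<pi>/2, 3\<pi>/2). If it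
    exceeded \<pi>, reduction by 2\<pi> would make Im (Ln (z - 1)) negative, so no correction
    occurs.\<close>
  have Ln: "Ln (z - 1) = Ln z + Ln u"
    using Ln_times[of z u] z u Arg_u Arg_z Arg_z1 by (auto split: if_splits)
  have "rho_base p z = z - z powr of_real (1 / p) *
      (z powr of_real (1 - 1 / p) * u powr of_real (1 - 1 / p))"
    using z u Ln by (simp add: rho_base_def powr_def exp_add ring_distribs)
  also have "\<dots> = z - z powr (of_real (1 / p) + of_real (1 - 1 / p)) * u powr of_real (1 - 1 / p)"
    by (simp only: powr_add mult.assoc)
  also have "of_real (1 / p) + of_real (1 - 1 / p) = (1 :: complex)"
    by simp
  finally have "rho_base p z = z * (1 - u powr of_real (1 - 1 / p))"
    using z by (simp add: algebra_simps)
  then show ?thesis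
    using z by (simp add: binomial_quotient_def u_def field_simps)
qed

text \<open>A positive factor x can be pulled out of a principal power, which yields the factor
  x^(p-1) of \<open>rho_formula\<close>. At x = 0 both sides vanish, the left one by the limit
  convention.\<close>

lemma rho_eq_Im_rho_base:
  assumes "p > 1" "0 \<le> x" "x \<le> 1"
  shows "rho p x = - (1 / pi) * Im (rho_base p (of_real x) powr of_real (p - 1))"
proof (cases "x = 0")
  case True
  then show ?thesis
    using assms by (simp add: rho_0 rho_base_def)
next
  case False
  define w where "w = 1 - exp (\<i> * of_real (pi / hoelder_conj p)) *
    of_real ((1 / x - 1) powr (1 / hoelder_conj p))"
  have q: "1 / hoelder_conj p = 1 - 1 / p"
    using assms by (simp add: hoelder_conj_def field_simps)
  have "pi / hoelder_conj p = pi * (1 - 1 / p)"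
    using q by (metis mult.right_neutral times_divide_eq_right)
  then have "rho_base p (of_real x) = of_real x * w"
    using assms False by (simp only: rho_base_of_real_inside w_def q)
  then have "rho_base p (of_real x) powr of_real (p - 1) =
      of_real x powr of_real (p - 1) * w powr of_real (p - 1)"
    using assms powr_times_real_left[of "of_real x" w "of_real (p - 1)"] by simp
  also have "of_real x powr of_real (p - 1) = complex_of_real (x powr (p - 1))"
    using assms by (intro powr_of_real) auto
  finally show ?thesis
    using False by (simp add: rho_def rho_formula_def w_def)
qed

text \<open>The half-plane integral applies with the base function raised to the power p - 1; its
  factor -\<pi> cancels the -1/\<pi> in the density. The weight x^n selects the coefficient of
  1/z^(n+1).\<close>

lemma integral_rho_moment:
  assumes "p > 1"
  shows "integral {0..1} (\<lambda>x. x ^ n * rho p x) = moment_coeff p (n + 1)"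
proof -
  define G where "G z = rho_base p z powr of_real (p - 1)" for z
  define H where "H w = binomial_quotient (1 - 1 / p) w powr of_real (p - 1)" for w
  have "integral {0..1} (\<lambda>x. x ^ n * Im (G (of_real x))) = - pi * moment_coeff p (n + 1)"
  proof (rule integral_Im_upper_half_plane)
    show "continuous_on {z. Im z \<ge> 0} G"
      unfolding G_def using assms rho_base_avoids_negative_reals[OF assms]
      by (intro continuous_on_powr_complex continuous_on_rho_base continuous_on_const) auto
    show "G holomorphic_on {z. Im z > 0}"
      unfolding G_def using Im_rho_base_neg[OF assms]
      by (intro holomorphic_on_powr holomorphic_on_rho_base holomorphic_on_const)
         (fastforce simp: complex_nonpos_Reals_iff)
    show "Im (G (of_real x)) = 0" if "x \<notin> {0..1}" for x
    proof -
      from that obtain t where "t \<ge> 0" "rho_base p (of_real x) = of_real t"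
        using rho_base_of_real_outside[OF assms, of x] by auto
      then have "G (of_real x) = of_real (t powr (p - 1))"
        unfolding G_def by (simp only: powr_of_real)
      then show ?thesis by simp
    qed
    show "H has_fps_expansion Abs_fps (\<lambda>j. of_real (moment_coeff p j))"
      unfolding H_def using assms by (rule binomial_quotient_powr_has_fps_expansion)
    show "G z = H (inverse z)" if "Im z \<ge> 0" "norm z > 1" for z
      using rho_base_eq_binomial_quotient[OF that] by (simp add: G_def H_def)
  qed simp
  moreover have "integral {0..1} (\<lambda>x. x ^ n * rho p x) =
      integral {0..1} (\<lambda>x. - (1 / pi) * (x ^ n * Im (G (of_real x))))"
    using assms by (intro integral_cong) (simp add: rho_eq_Im_rho_base G_def)
  ultimately show ?thesis
    by simp
qed

lemma moment_even:
  assumes "p > 1" "even j"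
  shows "moment p j = 2 * integral {0..1} (\<lambda>x. x ^ j * rho p x)"
proof -
  define f where "f t = t ^ j * rho p \<bar>t\<bar>" for t
  have "f integrable_on {-1..1}"
    unfolding f_def using assms by (intro moment_integrable)
  then have "integral {-1..0} f + integral {0..1} f = moment p j"
    unfolding moment_def f_def[symmetric] by (intro Henstock_Kurzweil_Integration.integral_combine) auto
  moreover have "integral {-1..0} f = integral {0..1} f"
  proof -
    have "(\<lambda>x. f (- x)) = f"
      using assms by (auto simp: f_def)
    then show ?thesis
      using Henstock_Kurzweil_Integration.integral_reflect_real[of 1 0 f] by simp
  qed
  moreover have "integral {0..1} f = integral {0..1} (\<lambda>x. x ^ j * rho p x)"
    by (intro integral_cong) (simp add: f_def)
  ultimately show ?thesis by simp
qed

theorem proposition10: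
  fixes p :: real and k :: nat
  assumes "p > 1"
  shows "moment p (2 * k) =
    2 * ((p - 1) / p) powr (p - 1) *
      (\<Sum>n = 1..2 * k + 1. ((p - 1) gchoose n) *
        (\<Sum>rs | length rs = n \<and> (\<forall>r \<in> set rs. r \<ge> 1) \<and> sum_list rs = 2 * k + 1.
          \<Prod>r\<leftarrow>rs. pochhammer (1 / p) r / fact (r + 1)))"
proof -
  \<comment> \<open>The term n = 0 drops out: the empty composition cannot have the positive sum 2k
    + 1.\<close>
  have "{rs :: nat list. rs = [] \<and> (\<forall>r \<in> set rs. r \<ge> 1) \<and> sum_list rs = 2 * k + 1} = {}"
    by auto
  then have "moment_coeff p (2 * k + 1) =
    ((p - 1) / p) powr (p - 1) *
      (\<Sum>n = 1..2 * k + 1. ((p - 1) gchoose n) *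
        (\<Sum>rs | length rs = n \<and> (\<forall>r \<in> set rs. r \<ge> 1) \<and> sum_list rs = 2 * k + 1.
          \<Prod>r\<leftarrow>rs. pochhammer (1 / p) r / fact (r + 1)))"
    unfolding moment_coeff_def by (subst sum.atLeast_Suc_atMost) simp_all
  then show ?thesis
    using assms by (simp add: moment_even integral_rho_moment)
qed

end
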